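(* Consider the mixed-integer problem $$\min_{x,\beta}\Big\{c^\top x:\ x\in X,\ \ (\beta_\omega=0\Rightarrow Ax\ge b^\omega)\ \forall \omega\in\Omega,\ \ \sum_{\omega\in\Omega}p_\omega\beta_\omega\le\epsilon,\ \ \beta\in\{0,1\}^N\Big\},\qquad (\ast)$$ with data as in the context. Let $K\subseteq\Omega$ be a probability cover, i.e. $\sum_{\omega\in K}p_\omega>\epsilon$. Let $(\bar x,\bar\beta)$ be a fractional (optimal basic) solution of the LP relaxation of $(\ast)$ with $\sum_{\omega\in K}\bar\beta_\omega>|K|-1$. Let $J$ be the index set of the non-basic variables, $\{(r_x^j,r_\beta^j)\}_{j\in J}$ the corresponding extreme directions, and $\varphi^j(x,\beta)$, $j\in J$, the affine expressions of the non-basic variables. Then the inequality $$\sum_{j\in J}\max\left(0,\ \frac{\sum_{\omega\in K}r_{\beta,\omega}^j}{(|K|-1)-\sum_{\omega\in K}\bar\beta_\omega}\right)\varphi^j(x,\beta)\ \ge\ 1$$ is valid for $(\ast)$, i.e. it is satisfied by every feasible solution $(x,\beta)$ of $(\ast)$. Moreover, it is violated by $(\bar x,\bar\beta)$.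
   Context: Data: $\Omega=\{1,\dots,N\}$; probabilities $p_\omega>0$ with $\sum_{\omega\in\Omega}p_\omega=1$; risk tolerance $\epsilon\in(0,1)$ with $p_\omega\le\epsilon$ for all $\omega$; $X\subseteq\mathbb R_+^n$ a deterministic set; $A\in\mathbb R^{m\times n}$; $b^\omega\in\mathbb R_+^m$ (nonnegative) for each $\omega\in\Omega$. For each $\omega$ the polyhedron $\{x\in\mathbb R^n: Ax\ge b^\omega\}$ is nonempty. LP relaxation and tableau: the LP relaxation has as feasible region a polyhedron containing every feasible solution of $(\ast)$ and on which $0\le\beta_\omega\le1$. Fix the basis of the basic feasible solution $(\bar x,\bar\beta)$, with non-basic variables $s_j$, $j\in J$. In tableau form, every point of the LP relaxation (hence every feasible solution of $(\ast)$) can be written as $(x,\beta)=(\bar x,\bar\beta)+\sum_{j\in J}(r_x^j,r_\beta^j)s_j$ with $s_j\ge0$, where $(r_x^j,r_\beta^j)\in\mathbb R^n\times\mathbb R^N$ is the extreme direction associated with $s_j$, and $r_{\beta,\omega}^j$ is the $\omega$-component of $r_\beta^j$. The affine function $\varphi^j(x,\beta)$ expresses the value of the non-basic variable $s_j$ in terms of $(x,\beta)$; so $s_j=\varphi^j(x,\beta)\ge0$ on the LP relaxation and $\varphi^j(\bar x,\bar\beta)=0$. *)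

theory Defs
  imports "HOL-Analysis.Analysis"
begin

text \<open>
  The scenario set \<open>\<Omega>\<close> is the finite index type \<open>'w\<close>, so \<open>N = CARD('w)\<close>, and \<open>n = CARD('n)\<close>,
  \<open>m = CARD('m)\<close>. The order on vectors is componentwise.
\<close>

definition binary_vectors :: "(real ^ 'w) set" where
  "binary_vectors = {\<beta>. \<forall>\<omega>. \<beta> $ \<omega> \<in> {0, 1}}"

definition ccp_feasible ::
  "(real ^ 'n) set \<Rightarrow> real ^ 'n ^ 'm \<Rightarrow> ('w \<Rightarrow> real ^ 'm) \<Rightarrow> ('w \<Rightarrow> real) \<Rightarrow> real
    \<Rightarrow> ((real ^ 'n) \<times> (real ^ 'w)) set" where
  "ccp_feasible X A b p \<epsilon> =
     {(x, \<beta>). x \<in> X \<and> (\<forall>\<omega>. \<beta> $ \<omega> = 0 \<longrightarrow> b \<omega> \<le> A *v x) \<and>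
              (\<Sum>\<omega>\<in>UNIV. p \<omega> * \<beta> $ \<omega>) \<le> \<epsilon> \<and> \<beta> \<in> binary_vectors}"

text \<open>
  A linear program is described by finitely many equations (indices \<open>E\<close>) and inequalities
  (indices \<open>I\<close>, which include the bounds on the variables); \<open>a i\<close> is the coefficient vector of
  row \<open>i\<close> and \<open>d i\<close> its right-hand side. The simplex variable attached to \<open>i \<in> I\<close> is
  \<open>s\<^sub>i = a i \<bullet> z - d i\<close>: a structural variable \<open>z\<^sub>k\<close> if row \<open>i\<close> is \<open>z\<^sub>k \<ge> 0\<close>, a slack otherwise.
\<close>

definition lp_region ::
  "'i set \<Rightarrow> 'i set \<Rightarrow> ('i \<Rightarrow> 'a::euclidean_space) \<Rightarrow> ('i \<Rightarrow> real) \<Rightarrow> 'a set" where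
  "lp_region E I a d = {z. (\<forall>i\<in>E. a i \<bullet> z = d i) \<and> (\<forall>i\<in>I. d i \<le> a i \<bullet> z)}"

definition lp_var :: "('i \<Rightarrow> 'a::euclidean_space) \<Rightarrow> ('i \<Rightarrow> real) \<Rightarrow> 'i \<Rightarrow> 'a \<Rightarrow> real" where
  "lp_var a d i z = a i \<bullet> z - d i"

text \<open>
  \<open>J\<close> is the set of non-basic variables of a basis: the rows in \<open>J\<close> are linearly independent
  modulo the equation rows and complete them to a system of full rank. The equation rows
  themselves may be redundant.
\<close>

definition nonbasic_set :: "'i set \<Rightarrow> 'i set \<Rightarrow> ('i \<Rightarrow> 'a::euclidean_space) \<Rightarrow> 'i set \<Rightarrow> bool" where
  "nonbasic_set E I a J \<longleftrightarrow>
     J \<subseteq> I \<and> span (a ` (E \<union> J)) = UNIV \<and> (\<forall>j\<in>J. a j \<notin> span (a ` (E \<union> (J - {j}))))"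

definition basic_feasible_solution ::
  "'i set \<Rightarrow> 'i set \<Rightarrow> ('i \<Rightarrow> 'a::euclidean_space) \<Rightarrow> ('i \<Rightarrow> real) \<Rightarrow> 'i set \<Rightarrow> 'a \<Rightarrow> bool" where
  "basic_feasible_solution E I a d J z \<longleftrightarrow>
     nonbasic_set E I a J \<and> z \<in> lp_region E I a d \<and> (\<forall>j\<in>J. lp_var a d j z = 0)"

text \<open>
  The column of \<open>s\<^sub>j\<close> in the tableau: the change of \<open>z\<close> when \<open>s\<^sub>j\<close> increases by one unit while the
  equations and the other non-basic variables stay unchanged.
\<close>

definition extreme_direction ::
  "'i set \<Rightarrow> ('i \<Rightarrow> 'a::euclidean_space) \<Rightarrow> 'i set \<Rightarrow> 'i \<Rightarrow> 'a \<Rightarrow> bool" where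
  "extreme_direction E a J j r \<longleftrightarrow>
     (\<forall>i\<in>E. a i \<bullet> r = 0) \<and> (\<forall>k\<in>J. a k \<bullet> r = (if k = j then 1 else 0))"

definition lp_relaxation ::
  "'i set \<Rightarrow> 'i set \<Rightarrow> ('i \<Rightarrow> (real ^ 'n) \<times> (real ^ 'w)) \<Rightarrow> ('i \<Rightarrow> real)
    \<Rightarrow> ((real ^ 'n) \<times> (real ^ 'w)) set \<Rightarrow> bool" where
  "lp_relaxation E I a d F \<longleftrightarrow>
     finite E \<and> finite I \<and> F \<subseteq> lp_region E I a d \<and>
     (\<forall>(x, \<beta>)\<in>lp_region E I a d. \<forall>\<omega>. 0 \<le> \<beta> $ \<omega> \<and> \<beta> $ \<omega> \<le> 1)"

end

theory Submission
  imports Defs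
begin

text \<open>
  The inequality is an intersection cut for a half-space. A feasible \<open>\<beta>\<close> is binary, and setting
  all of a probability cover \<open>K\<close> to one would exceed the risk tolerance; so every feasible point
  lies in the half-space \<open>\<Sum>\<omega>\<in>K. \<beta> $ \<omega> \<le> card K - 1\<close>
  (\<open>cover_inequality\<close>), while by assumption the basic solution lies strictly outside it.

  The tableau \<open>z = zbar + (\<Sum>j\<in>J. s\<^sub>j r\<^sub>j)\<close> (\<open>tableau_representation\<close>) rewrites this half-space in
  terms of the non-basic variables. Dividing by the negative number
  \<open>\<delta> = (card K - 1) - (\<Sum>\<omega>\<in>K. \<beta>bar $ \<omega>)\<close> turns it into \<open>(\<Sum>j\<in>J. (\<rho>\<^sub>j / \<delta>) s\<^sub>j) \<ge> 1\<close>, where \<open>\<rho>\<^sub>j\<close> is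
  the rate at which the left-hand side of the cover inequality changes along \<open>r\<^sub>j\<close>. Replacing
  negative coefficients by zero does not lower the left-hand side, because \<open>s\<^sub>j \<ge> 0\<close>
  (\<open>halfspace_intersection_cut\<close>). At the basic solution every \<open>s\<^sub>j\<close> vanishes, so the left-hand side
  is \<open>0\<close> there and the inequality fails.
\<close>

text \<open>
  The two sides of the equation have the same inner product with every equation row and with every
  non-basic row. These rows span the space, so no nonzero vector is orthogonal to all of them.
\<close>

lemma tableau_representation:
  fixes a :: "'i \<Rightarrow> 'a::euclidean_space"
  assumes J: "finite J" "span (a ` (E \<union> J)) = UNIV"
    and zbar: "\<forall>i\<in>E. a i \<bullet> zbar = d i" "\<forall>j\<in>J. lp_var a d j zbar = 0"
    and r: "\<forall>j\<in>J. extreme_direction E a J j (r j)"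
    and z: "\<forall>i\<in>E. a i \<bullet> z = d i"
  shows "z = zbar + (\<Sum>j\<in>J. lp_var a d j z *\<^sub>R r j)"
proof -
  define w where "w = z - (zbar + (\<Sum>j\<in>J. lp_var a d j z *\<^sub>R r j))"
  have "orthogonal w (a i)" if "i \<in> E \<union> J" for i
  proof (cases "i \<in> E")
    case True
    then have "(\<Sum>j\<in>J. lp_var a d j z * (a i \<bullet> r j)) = 0"
      using r by (intro sum.neutral) (auto simp: extreme_direction_def)
    then have "a i \<bullet> w = 0"
      using True zbar z by (simp add: w_def inner_diff_right inner_add_right inner_sum_right)
    then show ?thesis by (simp add: orthogonal_def inner_commute)
  next
    case False
    with that have i: "i \<in> J" by simp
    have "(\<Sum>j\<in>J. lp_var a d j z * (a i \<bullet> r j)) = (\<Sum>j\<in>J. if j = i then lp_var a d j z else 0)"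
      using r i by (intro sum.cong) (auto simp: extreme_direction_def)
    also have "\<dots> = lp_var a d i z" using i J(1) by simp
    finally have "a i \<bullet> w = 0"
      using i zbar by (simp add: w_def inner_diff_right inner_add_right inner_sum_right lp_var_def)
    then show ?thesis by (simp add: orthogonal_def inner_commute)
  qed
  then have "orthogonal w w"
    using J(2) by (intro orthogonal_to_span[of w "a ` (E \<union> J)"]) auto
  then show ?thesis by (simp add: w_def orthogonal_self)
qed

text \<open>
  If \<open>f z \<le> \<kappa> < f zbar\<close>, then moving from \<open>zbar\<close> to \<open>z\<close> lowers \<open>f\<close> by at least \<open>f zbar - \<kappa>\<close>. The
  tableau splits this decrease among the extreme directions, and only the directions along which
  \<open>f\<close> decreases contribute to it.
\<close>

lemma halfspace_intersection_cut:
  fixes a :: "'i \<Rightarrow> 'a::euclidean_space" and f :: "'a \<Rightarrow> real"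
  assumes f: "linear f" and J: "finite J"
    and basic: "basic_feasible_solution E I a d J zbar"
    and r: "\<forall>j\<in>J. extreme_direction E a J j (r j)"
    and z: "z \<in> lp_region E I a d"
    and halfspace: "f z \<le> \<kappa>" "\<kappa> < f zbar"
  shows "1 \<le> (\<Sum>j\<in>J. max 0 (f (r j) / (\<kappa> - f zbar)) * lp_var a d j z)"
proof -
  let ?s = "\<lambda>j. lp_var a d j z"
  have s_nonneg: "0 \<le> ?s j" if "j \<in> J" for j
    using that basic z
    by (auto simp: basic_feasible_solution_def nonbasic_set_def lp_region_def lp_var_def)
  have "z = zbar + (\<Sum>j\<in>J. ?s j *\<^sub>R r j)"
    using basic z
    by (intro tableau_representation[OF J _ _ _ r])
      (auto simp: basic_feasible_solution_def nonbasic_set_def lp_region_def)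
  then have "f z = f (zbar + (\<Sum>j\<in>J. ?s j *\<^sub>R r j))"
    by (rule arg_cong)
  also have "\<dots> = f zbar + (\<Sum>j\<in>J. ?s j * f (r j))"
    by (simp add: linear_add[OF f] linear_sum[OF f] linear_scale[OF f])
  finally have "(\<Sum>j\<in>J. ?s j * f (r j)) \<le> \<kappa> - f zbar"
    using halfspace(1) by simp
  then have "1 \<le> (\<Sum>j\<in>J. ?s j * f (r j)) / (\<kappa> - f zbar)"
    using halfspace(2) by (simp add: le_divide_eq)
  also have "\<dots> = (\<Sum>j\<in>J. f (r j) / (\<kappa> - f zbar) * ?s j)"
    by (simp add: sum_divide_distrib mult.commute)
  also have "\<dots> \<le> (\<Sum>j\<in>J. max 0 (f (r j) / (\<kappa> - f zbar)) * ?s j)"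
    using s_nonneg by (intro sum_mono mult_right_mono) auto
  finally show ?thesis .
qed

text \<open>
  If every component in \<open>K\<close> were one, then \<open>K\<close> alone would already exceed the budget \<open>\<epsilon>\<close>. So some
  component in \<open>K\<close> is zero and the others are at most one.
\<close>

lemma cover_inequality:
  fixes \<beta> :: "real ^ 'w::finite" and p :: "'w \<Rightarrow> real"
  assumes p: "\<forall>\<omega>. 0 \<le> p \<omega>" and cover: "\<epsilon> < (\<Sum>\<omega>\<in>K. p \<omega>)"
    and \<beta>: "\<beta> \<in> binary_vectors" and budget: "(\<Sum>\<omega>\<in>UNIV. p \<omega> * \<beta> $ \<omega>) \<le> \<epsilon>"
  shows "(\<Sum>\<omega>\<in>K. \<beta> $ \<omega>) \<le> real (card K) - 1"
proof -
  have binary: "\<beta> $ \<omega> = 0 \<or> \<beta> $ \<omega> = 1" for \<omega>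
    using \<beta> by (auto simp: binary_vectors_def)
  have "\<exists>k\<in>K. \<beta> $ k = 0"
  proof (rule ccontr)
    assume "\<not> (\<exists>k\<in>K. \<beta> $ k = 0)"
    then have "(\<Sum>\<omega>\<in>K. p \<omega>) = (\<Sum>\<omega>\<in>K. p \<omega> * \<beta> $ \<omega>)"
      using binary by (intro sum.cong) auto
    also have "\<dots> \<le> (\<Sum>\<omega>\<in>UNIV. p \<omega> * \<beta> $ \<omega>)"
    proof (rule sum_mono2)
      show "0 \<le> p \<omega> * \<beta> $ \<omega>" for \<omega>
        using p binary[of \<omega>] by auto
    qed auto
    finally show False using cover budget by simp
  qed
  then obtain k where k: "k \<in> K" "\<beta> $ k = 0" by blast
  have "(\<Sum>\<omega>\<in>K. \<beta> $ \<omega>) = (\<Sum>\<omega>\<in>K - {k}. \<beta> $ \<omega>)"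
    using k by (simp add: sum.remove[of K k])
  also have "\<dots> \<le> (\<Sum>\<omega>\<in>K - {k}. 1)"
  proof (rule sum_mono)
    show "\<beta> $ \<omega> \<le> 1" for \<omega> using binary[of \<omega>] by auto
  qed
  also have "\<dots> = real (card (K - {k}))" by simp
  also have "\<dots> = real (card K) - 1"
    using card_Suc_Diff1[OF finite k(1)] by linarith
  finally show ?thesis .
qed

theorem theorem3:
  fixes p :: "'w::finite \<Rightarrow> real" and \<epsilon> :: real
    and X :: "(real ^ 'n::finite) set"
    and A :: "real ^ 'n ^ 'm::finite" and b :: "'w \<Rightarrow> real ^ 'm"
    and c :: "real ^ 'n"
    and K :: "'w set"
    and E I J :: "'i set"
    and a :: "'i \<Rightarrow> (real ^ 'n) \<times> (real ^ 'w)" and d :: "'i \<Rightarrow> real"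
    and xbar :: "real ^ 'n" and \<beta>bar :: "real ^ 'w"
    and r_x :: "'i \<Rightarrow> real ^ 'n" and r_\<beta> :: "'i \<Rightarrow> real ^ 'w"
    and \<phi> :: "'i \<Rightarrow> (real ^ 'n) \<times> (real ^ 'w) \<Rightarrow> real"
  assumes "\<forall>\<omega>. 0 < p \<omega>" and "(\<Sum>\<omega>\<in>UNIV. p \<omega>) = 1"
    and "0 < \<epsilon>" and "\<epsilon> < 1" and "\<forall>\<omega>. p \<omega> \<le> \<epsilon>"
    and "\<forall>x\<in>X. 0 \<le> x"
    and "\<forall>\<omega>. 0 \<le> b \<omega>"
    and "\<forall>\<omega>. {x. b \<omega> \<le> A *v x} \<noteq> {}"
    and cover: "(\<Sum>\<omega>\<in>K. p \<omega>) > \<epsilon>"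
    and relaxation: "lp_relaxation E I a d (ccp_feasible X A b p \<epsilon>)"
    and basic: "basic_feasible_solution E I a d J (xbar, \<beta>bar)"
    and optimal: "\<forall>(x, \<beta>)\<in>lp_region E I a d. c \<bullet> xbar \<le> c \<bullet> x"
    and fractional: "\<beta>bar \<notin> binary_vectors"
    and separated: "(\<Sum>\<omega>\<in>K. \<beta>bar $ \<omega>) > real (card K) - 1"
    and directions: "\<forall>j\<in>J. extreme_direction E a J j (r_x j, r_\<beta> j)"
    and nonbasic_vars: "\<forall>j\<in>J. \<phi> j = lp_var a d j"
  shows "(\<forall>(x, \<beta>)\<in>ccp_feasible X A b p \<epsilon>.
            (\<Sum>j\<in>J. max 0 ((\<Sum>\<omega>\<in>K. r_\<beta> j $ \<omega>) /
                            ((real (card K) - 1) - (\<Sum>\<omega>\<in>K. \<beta>bar $ \<omega>))) * \<phi> j (x, \<beta>)) \<ge> 1)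
         \<and> \<not> (\<Sum>j\<in>J. max 0 ((\<Sum>\<omega>\<in>K. r_\<beta> j $ \<omega>) /
                            ((real (card K) - 1) - (\<Sum>\<omega>\<in>K. \<beta>bar $ \<omega>))) * \<phi> j (xbar, \<beta>bar)) \<ge> 1"
proof -
  define f :: "(real ^ 'n) \<times> (real ^ 'w) \<Rightarrow> real" where "f = (\<lambda>z. \<Sum>\<omega>\<in>K. snd z $ \<omega>)"
  have f: "linear f"
    unfolding f_def by (rule linearI) (auto simp: sum.distrib sum_distrib_left)
  have J: "finite J"
    using basic relaxation
    by (auto simp: basic_feasible_solution_def nonbasic_set_def lp_relaxation_def
        intro: finite_subset)
  have "1 \<le> (\<Sum>j\<in>J. max 0 ((\<Sum>\<omega>\<in>K. r_\<beta> j $ \<omega>) /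
                 ((real (card K) - 1) - (\<Sum>\<omega>\<in>K. \<beta>bar $ \<omega>))) * \<phi> j (x, \<beta>))"
    if feasible: "(x, \<beta>) \<in> ccp_feasible X A b p \<epsilon>" for x \<beta>
  proof -
    have "(x, \<beta>) \<in> lp_region E I a d"
      using relaxation feasible by (auto simp: lp_relaxation_def)
    moreover have "f (x, \<beta>) \<le> real (card K) - 1"
      using cover_inequality[of p \<epsilon> K \<beta>] assms(1) cover feasible
      by (auto simp: f_def ccp_feasible_def less_imp_le)
    moreover have "real (card K) - 1 < f (xbar, \<beta>bar)"
      using separated by (simp add: f_def)
    ultimately have "1 \<le> (\<Sum>j\<in>J. max 0 (f (r_x j, r_\<beta> j) /
        ((real (card K) - 1) - f (xbar, \<beta>bar))) * lp_var a d j (x, \<beta>))"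
      by (intro halfspace_intersection_cut[OF f J basic directions])
    then show ?thesis using nonbasic_vars by (simp add: f_def)
  qed
  moreover have "\<phi> j (xbar, \<beta>bar) = 0" if "j \<in> J" for j
    using that basic nonbasic_vars by (simp add: basic_feasible_solution_def)
  ultimately show ?thesis by auto
qed

end
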